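(* Let $A$ be a vector space. (i) Let $C^{*+1}_c(A,A) := \bigoplus_{n\geq 0} C^{n+1}_c(A,A)$, where $C^1_c(A,A) = C^1(A,A)$ and $C^{n+1}_c(A,A) = \underbrace{C^{n+1}(A,A)\oplus\cdots\oplus C^{n+1}(A,A)}_{(n+1)\text{ times}}$ for $n\geq 1$, with $C^{n+1}_c(A,A)$ placed in degree $n$. Then $C^{*+1}_c(A,A)$ is a graded Lie algebra with the bracket $[\![~,~]\!]$ defined, for $(f_1,\ldots,f_{m+1})\in C^{m+1}_c(A,A)$ and $(g_1,\ldots,g_{n+1})\in C^{n+1}_c(A,A)$, by letting $[\![(f_1,\ldots,f_{m+1}),(g_1,\ldots,g_{n+1})]\!] \in C_c^{m+n+1}(A,A)$ be the tuple whose $i$-th entry ($1\le i\le m+n+1$) is $\sum_{q+r=i+1,\ 1\le q\le m+1,\ 1\le r\le n+1}[f_q,g_r]_G$. Moreover, the map $\phi: C^{*+1}_c(A,A)\to C^{*+1}(A,A)$, $(f_1,\ldots,f_{n+1})\mapsto f_1+\cdots+f_{n+1}$ for $n\geq 0$, is a morphism of graded Lie algebras. (ii) A pair $(\mu_1,\mu_2)\in C^2(A,A)\oplus C^2(A,A)$ defines a compatible associative algebra structure on $A$ if and only if $(\mu_1,\mu_2)\in C^2_c(A,A)$ is a Maurer-Cartan element in the graded Lie algebra $(C^{*+1}_c(A,A),[\![~,~]\!])$, i.e. $[\![(\mu_1,\mu_2),(\mu_1,\mu_2)]\!]=0$.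
   Context: All vector spaces are finite-dimensional over a field $\mathbb{K}$ of characteristic $0$. $C^n(A,A)=\mathrm{Hom}(A^{\otimes n},A)$. The graded space $C^{*+1}(A,A)=\bigoplus_{n\ge0}C^{n+1}(A,A)$, with $C^{n+1}(A,A)$ in degree $n$, is a graded Lie algebra under the Gerstenhaber bracket: for $f\in C^{m+1}(A,A)$, $g\in C^{n+1}(A,A)$, $$[f,g]_G = f\diamond g-(-1)^{mn}g\diamond f,\qquad (f\diamond g)(a_1,\ldots,a_{m+n+1})=\sum_{i=1}^{m+1}(-1)^{(i-1)n}f(a_1,\ldots,a_{i-1},g(a_i,\ldots,a_{i+n}),a_{i+n+1},\ldots,a_{m+n+1}).$$ A graded Lie algebra has a degree $0$ bracket satisfying $[x,y] = -(-1)^{mn}[y,x]$ and $[x,[y,z]] = [[x,y],z] + (-1)^{mn}[y,[x,z]]$ for $x$ of degree $m$, $y$ of degree $n$. A compatible associative algebra structure on $A$ is a pair $(\mu_1,\mu_2)$ of associative bilinear products on $A$, written $a\cdot_1 b$ and $a\cdot_2 b$, with $(a\cdot_1 b)\cdot_2 c+(a\cdot_2 b)\cdot_1 c=a\cdot_1(b\cdot_2 c)+a\cdot_2(b\cdot_1 c)$ for all $a,b,c\in A$. *)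

theory Defs
  imports Complex_Main "HOL-Library.Function_Algebras" "HOL-Library.Poly_Mapping"
begin

section \<open>Graded Lie algebras\<close>

text \<open>
  A graded vector space is given by a family \<open>V\<close> of subspaces of an ambient vector space \<open>'v\<close>.
  Its total space, the direct sum of the \<open>V n\<close>, consists of the finitely supported families
  with \<open>n\<close>-th entry in \<open>V n\<close>; the element \<open>single n v\<close> is \<open>v\<close> placed in degree \<open>n\<close>.
  In particular \<open>0\<close> is homogeneous of every degree.
\<close>

definition direct_sum :: "(nat \<Rightarrow> 'v::zero set) \<Rightarrow> (nat \<Rightarrow>\<^sub>0 'v) set" where
  "direct_sum V = {x. \<forall>n. Poly_Mapping.lookup x n \<in> V n}"

definition homogeneous :: "(nat \<Rightarrow> 'v::zero set) \<Rightarrow> nat \<Rightarrow> (nat \<Rightarrow>\<^sub>0 'v) set" where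
  "homogeneous V n = Poly_Mapping.single n ` V n"

definition dscale :: "('k \<Rightarrow> 'v::zero \<Rightarrow> 'v) \<Rightarrow> 'k \<Rightarrow> (nat \<Rightarrow>\<^sub>0 'v) \<Rightarrow> (nat \<Rightarrow>\<^sub>0 'v)" where
  "dscale scale c x = Poly_Mapping.map (scale c) x"

locale graded_lie_algebra = vector_space scale
  for scale :: "'k::field \<Rightarrow> 'v::ab_group_add \<Rightarrow> 'v" +
  fixes V :: "nat \<Rightarrow> 'v set"
    and bracket :: "(nat \<Rightarrow>\<^sub>0 'v) \<Rightarrow> (nat \<Rightarrow>\<^sub>0 'v) \<Rightarrow> (nat \<Rightarrow>\<^sub>0 'v)"
  assumes subspace_component: "subspace (V n)"
    and bracket_closed:
      "\<lbrakk>x \<in> direct_sum V; y \<in> direct_sum V\<rbrakk> \<Longrightarrow> bracket x y \<in> direct_sum V"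
    and bracket_add_left:
      "\<lbrakk>x \<in> direct_sum V; x' \<in> direct_sum V; y \<in> direct_sum V\<rbrakk>
        \<Longrightarrow> bracket (x + x') y = bracket x y + bracket x' y"
    and bracket_add_right:
      "\<lbrakk>x \<in> direct_sum V; y \<in> direct_sum V; y' \<in> direct_sum V\<rbrakk>
        \<Longrightarrow> bracket x (y + y') = bracket x y + bracket x y'"
    and bracket_scale_left:
      "\<lbrakk>x \<in> direct_sum V; y \<in> direct_sum V\<rbrakk>
        \<Longrightarrow> bracket (dscale scale c x) y = dscale scale c (bracket x y)"
    and bracket_scale_right:
      "\<lbrakk>x \<in> direct_sum V; y \<in> direct_sum V\<rbrakk>
        \<Longrightarrow> bracket x (dscale scale c y) = dscale scale c (bracket x y)"
    and bracket_degree: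
      "\<lbrakk>x \<in> homogeneous V m; y \<in> homogeneous V n\<rbrakk> \<Longrightarrow> bracket x y \<in> homogeneous V (m + n)"
    and bracket_skew:
      "\<lbrakk>x \<in> homogeneous V m; y \<in> homogeneous V n\<rbrakk>
        \<Longrightarrow> bracket x y = - dscale scale ((-1) ^ (m * n)) (bracket y x)"
    and bracket_jacobi:
      "\<lbrakk>x \<in> homogeneous V m; y \<in> homogeneous V n; z \<in> homogeneous V p\<rbrakk>
        \<Longrightarrow> bracket x (bracket y z) =
          bracket (bracket x y) z + dscale scale ((-1) ^ (m * n)) (bracket y (bracket x z))"

locale graded_lie_morphism =
  source: graded_lie_algebra scale1 V1 bracket1 + target: graded_lie_algebra scale2 V2 bracket2
  for scale1 :: "'k::field \<Rightarrow> 'v::ab_group_add \<Rightarrow> 'v" and V1 bracket1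
    and scale2 :: "'k \<Rightarrow> 'w::ab_group_add \<Rightarrow> 'w" and V2 bracket2 +
  fixes \<phi> :: "(nat \<Rightarrow>\<^sub>0 'v) \<Rightarrow> (nat \<Rightarrow>\<^sub>0 'w)"
  assumes morphism_add:
      "\<lbrakk>x \<in> direct_sum V1; y \<in> direct_sum V1\<rbrakk> \<Longrightarrow> \<phi> (x + y) = \<phi> x + \<phi> y"
    and morphism_scale:
      "x \<in> direct_sum V1 \<Longrightarrow> \<phi> (dscale scale1 c x) = dscale scale2 c (\<phi> x)"
    and morphism_degree:
      "x \<in> homogeneous V1 n \<Longrightarrow> \<phi> x \<in> homogeneous V2 n"
    and morphism_bracket:
      "\<lbrakk>x \<in> direct_sum V1; y \<in> direct_sum V1\<rbrakk>
        \<Longrightarrow> \<phi> (bracket1 x y) = bracket2 (\<phi> x) (\<phi> y)"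

definition maurer_cartan ::
    "(nat \<Rightarrow> 'v::zero set) \<Rightarrow> ((nat \<Rightarrow>\<^sub>0 'v) \<Rightarrow> (nat \<Rightarrow>\<^sub>0 'v) \<Rightarrow> (nat \<Rightarrow>\<^sub>0 'v)) \<Rightarrow> (nat \<Rightarrow>\<^sub>0 'v) \<Rightarrow> bool"
  where "maurer_cartan V bracket x \<longleftrightarrow> x \<in> homogeneous V 1 \<and> bracket x x = 0"

text \<open>
  The (bi)additive extension to total spaces of maps given degree by degree: \<open>b m n\<close> is the map
  in degrees \<open>m\<close> and \<open>n\<close>, with values in degree \<open>m + n\<close>, and \<open>f n\<close> is the map in degree \<open>n\<close>.
\<close>

definition extend_bracket ::
    "(nat \<Rightarrow> nat \<Rightarrow> 'v \<Rightarrow> 'v \<Rightarrow> 'v::comm_monoid_add)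
      \<Rightarrow> (nat \<Rightarrow>\<^sub>0 'v) \<Rightarrow> (nat \<Rightarrow>\<^sub>0 'v) \<Rightarrow> (nat \<Rightarrow>\<^sub>0 'v)" where
  "extend_bracket b x y =
    (\<Sum>m\<in>Poly_Mapping.keys x. \<Sum>n\<in>Poly_Mapping.keys y.
      Poly_Mapping.single (m + n) (b m n (Poly_Mapping.lookup x m) (Poly_Mapping.lookup y n)))"

definition extend_map ::
    "(nat \<Rightarrow> 'v \<Rightarrow> 'w) \<Rightarrow> (nat \<Rightarrow>\<^sub>0 'v::zero) \<Rightarrow> (nat \<Rightarrow>\<^sub>0 'w::comm_monoid_add)" where
  "extend_map f x =
    (\<Sum>n\<in>Poly_Mapping.keys x. Poly_Mapping.single n (f n (Poly_Mapping.lookup x n)))"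

lemma extend_bracket_single:
  assumes "b m n 0 w = 0" "b m n v 0 = 0"
  shows "extend_bracket b (Poly_Mapping.single m v) (Poly_Mapping.single n w) =
    Poly_Mapping.single (m + n) (b m n v w)"
  using assms by (cases "v = 0"; cases "w = 0") (simp_all add: extend_bracket_def)


section \<open>Cochains and the Gerstenhaber bracket\<close>

type_synonym 'a cochain = "'a list \<Rightarrow> 'a"

text \<open>
  Elements of \<open>Hom(A\<^sup>\<otimes>\<^sup>n, A)\<close> are represented by \<open>n\<close>-linear maps, the \<open>n\<close> arguments forming a list.
  The value on lists of any other length is fixed to \<open>0\<close>, so that equality of cochains is
  equality of functions.
\<close>

definition cochains :: "('k::field \<Rightarrow> 'a::ab_group_add \<Rightarrow> 'a) \<Rightarrow> nat \<Rightarrow> 'a cochain set" where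
  "cochains scale n = {f.
    (\<forall>as. length as \<noteq> n \<longrightarrow> f as = 0) \<and>
    (\<forall>as i. length as = n \<longrightarrow> i < n \<longrightarrow> Vector_Spaces.linear scale scale (\<lambda>x. f (as[i := x])))}"

definition cochain_scale :: "('k \<Rightarrow> 'a \<Rightarrow> 'a) \<Rightarrow> 'k \<Rightarrow> 'a cochain \<Rightarrow> 'a cochain" where
  "cochain_scale scale c f = (\<lambda>as. scale c (f as))"

text \<open>
  \<open>gerst_circ scale m n f g\<close> is \<open>f \<diamond> g\<close> for \<open>f\<close> and \<open>g\<close> of degrees \<open>m\<close> and \<open>n\<close>, that is, of
  arities \<open>m + 1\<close> and \<open>n + 1\<close>.
\<close>

definition gerst_circ ::
    "('k::field \<Rightarrow> 'a::ab_group_add \<Rightarrow> 'a) \<Rightarrow> nat \<Rightarrow> nat \<Rightarrow> 'a cochain \<Rightarrow> 'a cochain \<Rightarrow> 'a cochain" where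
  "gerst_circ scale m n f g = (\<lambda>as.
    if length as = m + n + 1
    then \<Sum>i = 1..m + 1. scale ((-1) ^ ((i - 1) * n))
           (f (take (i - 1) as @ [g (take (n + 1) (drop (i - 1) as))] @ drop (i + n) as))
    else 0)"

definition gerst_bracket ::
    "('k::field \<Rightarrow> 'a::ab_group_add \<Rightarrow> 'a) \<Rightarrow> nat \<Rightarrow> nat \<Rightarrow> 'a cochain \<Rightarrow> 'a cochain \<Rightarrow> 'a cochain" where
  "gerst_bracket scale m n f g =
    gerst_circ scale m n f g - cochain_scale scale ((-1) ^ (m * n)) (gerst_circ scale n m g f)"

definition gerst_component ::
    "('k::field \<Rightarrow> 'a::ab_group_add \<Rightarrow> 'a) \<Rightarrow> nat \<Rightarrow> 'a cochain set" where
  "gerst_component scale n = cochains scale (n + 1)"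


section \<open>Tuples of cochains and the compatible bracket\<close>

text \<open>
  A tuple \<open>(f\<^sub>1, \<dots>, f\<^sub>n\<^sub>+\<^sub>1)\<close> is a function of the index that vanishes outside \<open>{1..n + 1}\<close>.
\<close>

type_synonym 'a cochain_tuple = "nat \<Rightarrow> 'a cochain"

definition compat_component ::
    "('k::field \<Rightarrow> 'a::ab_group_add \<Rightarrow> 'a) \<Rightarrow> nat \<Rightarrow> 'a cochain_tuple set" where
  "compat_component scale n = {F.
    (\<forall>i\<in>{1..n + 1}. F i \<in> cochains scale (n + 1)) \<and> (\<forall>i. i \<notin> {1..n + 1} \<longrightarrow> F i = 0)}"

definition tuple_scale :: "('k \<Rightarrow> 'a \<Rightarrow> 'a) \<Rightarrow> 'k \<Rightarrow> 'a cochain_tuple \<Rightarrow> 'a cochain_tuple" where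
  "tuple_scale scale c F = (\<lambda>i. cochain_scale scale c (F i))"

text \<open>For \<open>i\<close> outside \<open>{1..m + n + 1}\<close> the sum below is empty, as required of tuples.\<close>

definition compat_bracket ::
    "('k::field \<Rightarrow> 'a::ab_group_add \<Rightarrow> 'a) \<Rightarrow> nat \<Rightarrow> nat
      \<Rightarrow> 'a cochain_tuple \<Rightarrow> 'a cochain_tuple \<Rightarrow> 'a cochain_tuple" where
  "compat_bracket scale m n F G = (\<lambda>i.
    \<Sum>(q, r) \<in> {(q, r). q + r = i + 1 \<and> 1 \<le> q \<and> q \<le> m + 1 \<and> 1 \<le> r \<and> r \<le> n + 1}.
      gerst_bracket scale m n (F q) (G r))"

text \<open>
  On homogeneous elements the extended bracket is given by the formula for tuples.
\<close>

lemma extend_compat_bracket_single: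
  assumes "vector_space scale" and F: "F \<in> compat_component scale m" and G: "G \<in> compat_component scale n"
  shows "extend_bracket (compat_bracket scale) (Poly_Mapping.single m F) (Poly_Mapping.single n G) =
    Poly_Mapping.single (m + n) (compat_bracket scale m n F G)"
proof -
  interpret vector_space scale by fact
  have circ0: "gerst_circ scale k l f 0 = 0 \<and> gerst_circ scale l k 0 f = 0"
    if f: "f \<in> cochains scale (k + 1)" for f k l
  proof -
    have "f (take (i - 1) as @ [0] @ drop (i + l) as) = 0"
      if "length as = k + l + 1" "i \<in> {1..k + 1}" for as i
    proof -
      let ?bs = "take (i - 1) as @ [0] @ drop (i + l) as"
      have len: "length ?bs = k + 1" "i - 1 < k + 1" using that by auto
      then have "Vector_Spaces.linear scale scale (\<lambda>x. f (?bs[i - 1 := x]))"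
        using f unfolding cochains_def by blast
      then have "f (?bs[i - 1 := 0]) = 0"
        using module_hom.zero[OF Vector_Spaces.linear.axioms(3)] by fastforce
      moreover have "?bs[i - 1 := 0] = ?bs" using that by (auto simp: list_update_append min_def split: nat.split)
      ultimately show ?thesis by simp
    qed
    then have "gerst_circ scale k l f 0 = 0"
      unfolding gerst_circ_def zero_fun_def by (intro ext) (simp del: append_Cons sum.cl_ivl_Suc)
    moreover have "gerst_circ scale l k 0 f = 0"
      by (simp add: gerst_circ_def fun_eq_iff)
    ultimately show ?thesis by blast
  qed
  have br0: "gerst_bracket scale k l f 0 = 0 \<and> gerst_bracket scale l k 0 f = 0"
    if f: "f \<in> cochains scale (k + 1)" for f k l
  proof -
    show ?thesis using circ0[OF f]
      by (simp add: gerst_bracket_def cochain_scale_def fun_eq_iff)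
  qed
  have "compat_bracket scale m n F 0 = 0" "compat_bracket scale m n 0 G = 0"
    using F G br0 unfolding compat_bracket_def compat_component_def zero_fun_def[where ?'a = nat]
    by (auto intro!: ext sum.neutral simp del: zero_fun_apply)
  then show ?thesis by (rule extend_bracket_single[rotated])
qed

definition tuple_sum :: "nat \<Rightarrow> 'a::ab_group_add cochain_tuple \<Rightarrow> 'a cochain" where
  "tuple_sum n F = (\<Sum>i = 1..n + 1. F i)"

definition pair_tuple :: "'a::ab_group_add cochain \<Rightarrow> 'a cochain \<Rightarrow> 'a cochain_tuple" where
  "pair_tuple f g = (\<lambda>i. if i = 1 then f else if i = 2 then g else 0)"


section \<open>Compatible associative algebras\<close>

definition bilinear_product ::
    "('k::field \<Rightarrow> 'a::ab_group_add \<Rightarrow> 'a) \<Rightarrow> ('a \<Rightarrow> 'a \<Rightarrow> 'a) \<Rightarrow> bool" where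
  "bilinear_product scale p \<longleftrightarrow>
    (\<forall>a. Vector_Spaces.linear scale scale (\<lambda>b. p a b)) \<and>
    (\<forall>b. Vector_Spaces.linear scale scale (\<lambda>a. p a b))"

definition associative_product :: "('a \<Rightarrow> 'a \<Rightarrow> 'a) \<Rightarrow> bool" where
  "associative_product p \<longleftrightarrow> (\<forall>a b c. p (p a b) c = p a (p b c))"

definition compatible_associative ::
    "('k::field \<Rightarrow> 'a::ab_group_add \<Rightarrow> 'a) \<Rightarrow> ('a \<Rightarrow> 'a \<Rightarrow> 'a) \<Rightarrow> ('a \<Rightarrow> 'a \<Rightarrow> 'a) \<Rightarrow> bool" where
  "compatible_associative scale p1 p2 \<longleftrightarrow>
    bilinear_product scale p1 \<and> associative_product p1 \<and>
    bilinear_product scale p2 \<and> associative_product p2 \<and>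
    (\<forall>a b c. p2 (p1 a b) c + p1 (p2 a b) c = p1 a (p2 b c) + p2 a (p1 b c))"

end

theory Submission
  imports Defs "HOL-Computational_Algebra.Polynomial"
begin

text \<open>
  The tuple \<open>(f\<^sub>1, \<dots>, f\<^sub>n\<^sub>+\<^sub>1)\<close> is best read as the polynomial
  \<open>f\<^sub>1 + t f\<^sub>2 + \<dots> + t\<^sup>n f\<^sub>n\<^sub>+\<^sub>1\<close> with coefficients in the cochains of degree \<open>n\<close>. Under this
  reading the condition \<open>q + r = i + 1\<close> says that exponents add up, so the bracket of tuples is the
  Gerstenhaber bracket extended to polynomials in \<open>t\<close>. Evaluation at a scalar \<open>t\<close> therefore carries
  it to the Gerstenhaber bracket (\<open>eval_tuple_compat_bracket\<close>). Over an infinite field a polynomial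
  is determined by its values (\<open>eval_tuple_inject\<close>), so every identity of the Gerstenhaber bracket
  is inherited by tuples (\<open>degreewise_lie_algebra_of_jointly_injective\<close>). The map \<open>\<phi>\<close> is
  evaluation at \<open>t = 1\<close>, and it is a morphism for the same reason.

  There remains the classical fact that cochains form a graded Lie algebra. It comes from the graded
  pre-Lie identity: in \<open>(f \<diamond> g) \<diamond> h\<close> the cochain \<open>h\<close> is inserted either into the inserted \<open>g\<close>, and
  these terms make up \<open>f \<diamond> (g \<diamond> h)\<close>, or into another argument of \<open>f\<close>. The terms of the second kind
  are symmetric, up to the sign \<open>(-1)\<^sup>n\<^sup>p\<close>, in \<open>g\<close> and \<open>h\<close> (\<open>gerst_circ_associator\<close>). The
  Jacobi identity is the combination of this symmetry for the associators headed by \<open>f\<close>, by \<open>g\<close>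
  and by \<open>h\<close>.

  For the Maurer-Cartan equation, the bracket of \<open>(\<mu>\<^sub>1, \<mu>\<^sub>2)\<close> with itself has the three entries
  \<open>[\<mu>\<^sub>1, \<mu>\<^sub>1]\<close>, \<open>2 [\<mu>\<^sub>1, \<mu>\<^sub>2]\<close> and \<open>[\<mu>\<^sub>2, \<mu>\<^sub>2]\<close>. As \<open>2\<close> is invertible, they vanish exactly when
  \<open>\<mu>\<^sub>1\<close> is associative, the mixed identity holds, and \<open>\<mu>\<^sub>2\<close> is associative.
\<close>

section \<open>Graded Lie algebras given degree by degree\<close>

lemma lookup_dscale:
  assumes "scale c 0 = 0"
  shows "Poly_Mapping.lookup (dscale scale c x) n = scale c (Poly_Mapping.lookup x n)"
  using assms by (simp add: dscale_def map.rep_eq when_def)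

lemma dscale_single:
  assumes "scale c 0 = 0"
  shows "dscale scale c (Poly_Mapping.single n v) = Poly_Mapping.single n (scale c v)"
  by (rule poly_mapping_eqI) (simp add: lookup_dscale assms lookup_single when_def)

text \<open>
  The data of a graded Lie algebra before passing to total spaces: \<open>b m n\<close> is the bracket of
  elements of degrees \<open>m\<close> and \<open>n\<close>. Skew symmetry transports its linearity from the left argument
  to the right one.
\<close>

locale degreewise_lie_algebra = vector_space scale
  for scale :: "'k::field \<Rightarrow> 'v::ab_group_add \<Rightarrow> 'v" +
  fixes V :: "nat \<Rightarrow> 'v set"
    and b :: "nat \<Rightarrow> nat \<Rightarrow> 'v \<Rightarrow> 'v \<Rightarrow> 'v"
  assumes subspace: "subspace (V n)"
    and closed: "\<lbrakk>x \<in> V m; y \<in> V n\<rbrakk> \<Longrightarrow> b m n x y \<in> V (m + n)"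
    and add_left: "\<lbrakk>x \<in> V m; x' \<in> V m; y \<in> V n\<rbrakk> \<Longrightarrow> b m n (x + x') y = b m n x y + b m n x' y"
    and scale_left: "\<lbrakk>x \<in> V m; y \<in> V n\<rbrakk> \<Longrightarrow> b m n (scale c x) y = scale c (b m n x y)"
    and skew: "\<lbrakk>x \<in> V m; y \<in> V n\<rbrakk> \<Longrightarrow> b m n x y = - scale ((-1) ^ (m * n)) (b n m y x)"
    and jacobi: "\<lbrakk>x \<in> V m; y \<in> V n; z \<in> V p\<rbrakk> \<Longrightarrow>
      b m (n + p) x (b n p y z) =
        b (m + n) p (b m n x y) z + scale ((-1) ^ (m * n)) (b n (m + p) y (b m p x z))"
begin

lemma add_right:
  assumes "x \<in> V m" "y \<in> V n" "y' \<in> V n"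
  shows "b m n x (y + y') = b m n x y + b m n x y'"
  using assms subspace
  by (simp add: skew[of x m _ n] add_left subspace_add scale_right_distrib)

lemma scale_right:
  assumes "x \<in> V m" "y \<in> V n"
  shows "b m n x (scale c y) = scale c (b m n x y)"
  using assms subspace
  by (simp add: skew[of x m _ n] scale_left subspace_scale mult.commute)

lemma zero_left: "y \<in> V n \<Longrightarrow> b m n 0 y = 0"
  using scale_left[of 0 m y n 0] subspace_0[OF subspace] by simp

lemma zero_right: "x \<in> V m \<Longrightarrow> b m n x 0 = 0"
  using scale_right[of x m 0 n 0] subspace_0[OF subspace] by simp

lemma sum_left:
  assumes "\<And>i. i \<in> I \<Longrightarrow> x i \<in> V m" "y \<in> V n"
  shows "b m n (\<Sum>i\<in>I. scale (c i) (x i)) y = (\<Sum>i\<in>I. scale (c i) (b m n (x i) y))"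
  using assms(1)
  by (induction I rule: infinite_finite_induct)
    (simp_all add: assms(2) zero_left add_left scale_left subspace_sum subspace_scale subspace)

lemma sum_right:
  assumes "x \<in> V m" "\<And>i. i \<in> I \<Longrightarrow> y i \<in> V n"
  shows "b m n x (\<Sum>i\<in>I. scale (c i) (y i)) = (\<Sum>i\<in>I. scale (c i) (b m n x (y i)))"
  using assms(2)
  by (induction I rule: infinite_finite_induct)
    (simp_all add: assms(1) zero_right add_right scale_right subspace_sum subspace_scale subspace)

lemma extend_bracket_on_single:
  assumes "x \<in> V m" "y \<in> V n"
  shows "extend_bracket b (Poly_Mapping.single m x) (Poly_Mapping.single n y) =
    Poly_Mapping.single (m + n) (b m n x y)"
  using assms by (intro extend_bracket_single zero_left zero_right)

text \<open>
  Bilinearity compares brackets of elements with different supports. Here both supports may be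
  enlarged to common finite sets, which turns additivity into a termwise statement.
\<close>

lemma extend_bracket_eq_sum:
  assumes x: "x \<in> direct_sum V" and y: "y \<in> direct_sum V"
    and S: "finite S" "Poly_Mapping.keys x \<subseteq> S" and T: "finite T" "Poly_Mapping.keys y \<subseteq> T"
  shows "extend_bracket b x y = (\<Sum>m\<in>S. \<Sum>n\<in>T.
    Poly_Mapping.single (m + n) (b m n (Poly_Mapping.lookup x m) (Poly_Mapping.lookup y n)))"
proof -
  have V: "Poly_Mapping.lookup x m \<in> V m" "Poly_Mapping.lookup y m \<in> V m" for m
    using x y by (auto simp: direct_sum_def)
  have "(\<Sum>m\<in>S. \<Sum>n\<in>T.
      Poly_Mapping.single (m + n) (b m n (Poly_Mapping.lookup x m) (Poly_Mapping.lookup y n))) =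
    (\<Sum>m\<in>S. \<Sum>n\<in>Poly_Mapping.keys y.
      Poly_Mapping.single (m + n) (b m n (Poly_Mapping.lookup x m) (Poly_Mapping.lookup y n)))"
    using T V by (intro sum.cong refl sum.mono_neutral_right)
      (auto simp: not_in_keys_iff_lookup_eq_zero zero_right)
  also have "\<dots> = extend_bracket b x y"
    unfolding extend_bracket_def using S V
    by (intro sum.mono_neutral_right) (auto simp: not_in_keys_iff_lookup_eq_zero zero_left)
  finally show ?thesis ..
qed

lemma direct_sum_add: "x \<in> direct_sum V \<Longrightarrow> y \<in> direct_sum V \<Longrightarrow> x + y \<in> direct_sum V"
  using subspace_add[OF subspace] by (auto simp: direct_sum_def lookup_add)

lemma direct_sum_dscale: "x \<in> direct_sum V \<Longrightarrow> dscale scale c x \<in> direct_sum V"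
  using subspace_scale[OF subspace] by (auto simp: direct_sum_def lookup_dscale)

lemma direct_sum_single: "v \<in> V n \<Longrightarrow> Poly_Mapping.single n v \<in> direct_sum V"
  using subspace_0[OF subspace] by (auto simp: direct_sum_def lookup_single when_def)

lemma direct_sum_sum: "(\<And>i. i \<in> I \<Longrightarrow> f i \<in> direct_sum V) \<Longrightarrow> sum f I \<in> direct_sum V"
  by (auto simp: direct_sum_def lookup_sum intro!: subspace_sum[OF subspace])

lemma keys_dscale: "Poly_Mapping.keys (dscale scale c x) \<subseteq> Poly_Mapping.keys x"
  by (auto simp: in_keys_iff lookup_dscale)

lemma extend_bracket_add_left:
  assumes x: "x \<in> direct_sum V" and x': "x' \<in> direct_sum V" and y: "y \<in> direct_sum V"
  shows "extend_bracket b (x + x') y = extend_bracket b x y + extend_bracket b x' y"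
proof -
  let ?S = "Poly_Mapping.keys x \<union> Poly_Mapping.keys x'" and ?T = "Poly_Mapping.keys y"
  have V: "Poly_Mapping.lookup x m \<in> V m" "Poly_Mapping.lookup x' m \<in> V m"
    "Poly_Mapping.lookup y m \<in> V m" for m using x x' y by (auto simp: direct_sum_def)
  have "extend_bracket b (x + x') y = (\<Sum>m\<in>?S. \<Sum>n\<in>?T. Poly_Mapping.single (m + n)
      (b m n (Poly_Mapping.lookup (x + x') m) (Poly_Mapping.lookup y n)))"
    using Poly_Mapping.keys_add[of x x'] x x' y
    by (intro extend_bracket_eq_sum direct_sum_add) auto
  also have "\<dots> = extend_bracket b x y + extend_bracket b x' y"
    using x x' y V
    by (simp add: extend_bracket_eq_sum[of _ _ ?S ?T] lookup_add add_left single_add sum.distrib)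
  finally show ?thesis .
qed

lemma extend_bracket_add_right:
  assumes x: "x \<in> direct_sum V" and y: "y \<in> direct_sum V" and y': "y' \<in> direct_sum V"
  shows "extend_bracket b x (y + y') = extend_bracket b x y + extend_bracket b x y'"
proof -
  let ?S = "Poly_Mapping.keys x" and ?T = "Poly_Mapping.keys y \<union> Poly_Mapping.keys y'"
  have V: "Poly_Mapping.lookup x m \<in> V m" "Poly_Mapping.lookup y m \<in> V m"
    "Poly_Mapping.lookup y' m \<in> V m" for m using x y y' by (auto simp: direct_sum_def)
  have "extend_bracket b x (y + y') = (\<Sum>m\<in>?S. \<Sum>n\<in>?T. Poly_Mapping.single (m + n)
      (b m n (Poly_Mapping.lookup x m) (Poly_Mapping.lookup (y + y') n)))"
    using Poly_Mapping.keys_add[of y y'] x y y'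
    by (intro extend_bracket_eq_sum direct_sum_add) auto
  also have "\<dots> = extend_bracket b x y + extend_bracket b x y'"
    using x y y' V
    by (simp add: extend_bracket_eq_sum[of _ _ ?S ?T] lookup_add add_right single_add sum.distrib)
  finally show ?thesis .
qed

lemma dscale_sum: "dscale scale c (sum f I) = (\<Sum>i\<in>I. dscale scale c (f i))"
  by (rule poly_mapping_eqI) (simp add: lookup_dscale lookup_sum scale_sum_right)

lemma extend_bracket_dscale:
  assumes x: "x \<in> direct_sum V" and y: "y \<in> direct_sum V"
  shows "extend_bracket b (dscale scale c x) y = dscale scale c (extend_bracket b x y)"
    and "extend_bracket b x (dscale scale c y) = dscale scale c (extend_bracket b x y)"
proof -
  let ?S = "Poly_Mapping.keys x" and ?T = "Poly_Mapping.keys y"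
  have V: "Poly_Mapping.lookup x m \<in> V m" "Poly_Mapping.lookup y m \<in> V m" for m
    using x y by (auto simp: direct_sum_def)
  note eqs = lookup_dscale scale_left scale_right dscale_sum dscale_single
  have "extend_bracket b (dscale scale c x) y = (\<Sum>m\<in>?S. \<Sum>n\<in>?T. Poly_Mapping.single (m + n)
      (b m n (Poly_Mapping.lookup (dscale scale c x) m) (Poly_Mapping.lookup y n)))"
    using keys_dscale x y by (intro extend_bracket_eq_sum direct_sum_dscale) auto
  also have "\<dots> = dscale scale c (extend_bracket b x y)"
    using x y V by (simp add: extend_bracket_eq_sum[of _ _ ?S ?T] eqs)
  finally show "extend_bracket b (dscale scale c x) y = dscale scale c (extend_bracket b x y)" .
  have "extend_bracket b x (dscale scale c y) = (\<Sum>m\<in>?S. \<Sum>n\<in>?T. Poly_Mapping.single (m + n)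
      (b m n (Poly_Mapping.lookup x m) (Poly_Mapping.lookup (dscale scale c y) n)))"
    using keys_dscale x y by (intro extend_bracket_eq_sum direct_sum_dscale) auto
  also have "\<dots> = dscale scale c (extend_bracket b x y)"
    using x y V by (simp add: extend_bracket_eq_sum[of _ _ ?S ?T] eqs)
  finally show "extend_bracket b x (dscale scale c y) = dscale scale c (extend_bracket b x y)" .
qed

lemma extend_bracket_closed:
  assumes "x \<in> direct_sum V" "y \<in> direct_sum V"
  shows "extend_bracket b x y \<in> direct_sum V"
  using assms unfolding extend_bracket_def
  by (intro direct_sum_sum direct_sum_single closed) (auto simp: direct_sum_def)

lemma graded_lie_algebra: "graded_lie_algebra scale V (extend_bracket b)"
proof
  fix x y z and m n p :: nat
  note on_single = extend_bracket_on_single closed dscale_single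
  show "extend_bracket b x y \<in> homogeneous V (m + n)"
    if "x \<in> homogeneous V m" "y \<in> homogeneous V n"
    using that by (auto simp: homogeneous_def on_single)
  show "extend_bracket b x y = - dscale scale ((-1) ^ (m * n)) (extend_bracket b y x)"
    if xy: "x \<in> homogeneous V m" "y \<in> homogeneous V n"
  proof -
    obtain v w where "x = Poly_Mapping.single m v" "y = Poly_Mapping.single n w" "v \<in> V m" "w \<in> V n"
      using xy by (auto simp: homogeneous_def)
    then show ?thesis
      by (simp add: on_single skew[of v m w n] single_uminus add.commute)
  qed
  show "extend_bracket b x (extend_bracket b y z) = extend_bracket b (extend_bracket b x y) z +
      dscale scale ((-1) ^ (m * n)) (extend_bracket b y (extend_bracket b x z))"
    if xyz: "x \<in> homogeneous V m" "y \<in> homogeneous V n" "z \<in> homogeneous V p"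
  proof -
    obtain u v w where "x = Poly_Mapping.single m u" "y = Poly_Mapping.single n v"
      "z = Poly_Mapping.single p w" "u \<in> V m" "v \<in> V n" "w \<in> V p"
      using xyz by (auto simp: homogeneous_def)
    then show ?thesis
      by (simp add: on_single jacobi[of u m v n w p] single_add add.assoc add.left_commute[of n m p])
  qed
qed (simp_all add: subspace extend_bracket_closed extend_bracket_add_left extend_bracket_add_right
       extend_bracket_dscale)

end

text \<open>
  Lie identities can be tested after applying any family of linear maps that separates points and
  turns one bracket into the other.
\<close>

lemma degreewise_lie_algebra_of_jointly_injective:
  fixes e :: "'t \<Rightarrow> nat \<Rightarrow> 'v::ab_group_add \<Rightarrow> 'w::ab_group_add"
  assumes target: "degreewise_lie_algebra scale2 V2 b2"
    and source: "vector_space scale1" "\<And>n. module.subspace scale1 (V1 n)"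
    and closed: "\<And>m n x y. \<lbrakk>x \<in> V1 m; y \<in> V1 n\<rbrakk> \<Longrightarrow> b1 m n x y \<in> V1 (m + n)"
    and e_mem: "\<And>t n x. x \<in> V1 n \<Longrightarrow> e t n x \<in> V2 n"
    and e_linear: "\<And>t n. Vector_Spaces.linear scale1 scale2 (e t n)"
    and e_bracket: "\<And>t m n x y. \<lbrakk>x \<in> V1 m; y \<in> V1 n\<rbrakk> \<Longrightarrow>
      e t (m + n) (b1 m n x y) = b2 m n (e t m x) (e t n y)"
    and inj: "\<And>n x y. \<lbrakk>x \<in> V1 n; y \<in> V1 n; \<And>t. e t n x = e t n y\<rbrakk> \<Longrightarrow> x = y"
  shows "degreewise_lie_algebra scale1 V1 b1"
proof -
  interpret L: degreewise_lie_algebra scale2 V2 b2 by fact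
  interpret S: vector_space scale1 by fact
  have e: "e t n (x + y) = e t n x + e t n y" "e t n (scale1 c x) = scale2 c (e t n x)"
    "e t n (- x) = - e t n x" for t n c x y
    using e_linear[of t n] module_hom.neg[OF Vector_Spaces.linear.axioms(3)[OF e_linear[of t n]]]
    by (auto simp: Vector_Spaces.linear_iff)
  note mem = closed e_mem S.subspace_add S.subspace_scale S.subspace_neg source(2)
  show ?thesis
  proof
    fix m n p x x' y z c
    show "b1 m n (x + x') y = b1 m n x y + b1 m n x' y"
      if "x \<in> V1 m" "x' \<in> V1 m" "y \<in> V1 n"
      by (rule inj[of _ "m + n"]) (simp_all add: that mem e e_bracket L.add_left)
    show "b1 m n (scale1 c x) y = scale1 c (b1 m n x y)" if "x \<in> V1 m" "y \<in> V1 n"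
      by (rule inj[of _ "m + n"]) (simp_all add: that mem e e_bracket L.scale_left)
    show "b1 m n x y = - scale1 ((-1) ^ (m * n)) (b1 n m y x)" if xy: "x \<in> V1 m" "y \<in> V1 n"
    proof -
      \<comment> \<open>The two sides lie in the degrees \<open>m + n\<close> and \<open>n + m\<close>, which must be identified
        before the separating maps of that degree can be applied.\<close>
      have 1: "b1 n m y x \<in> V1 (m + n)" "\<And>t. e t (m + n) (b1 n m y x) = b2 n m (e t n y) (e t m x)"
        using closed[OF xy(2,1)] e_bracket[OF xy(2,1)] by (simp_all add: add.commute)
      show ?thesis
        using L.skew[OF e_mem[OF xy(1)] e_mem[OF xy(2)]]
        by (intro inj[of _ "m + n"]) (simp_all add: xy mem 1 e e_bracket)
    qed
    show "b1 m (n + p) x (b1 n p y z) =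
        b1 (m + n) p (b1 m n x y) z + scale1 ((-1) ^ (m * n)) (b1 n (m + p) y (b1 m p x z))"
      if xyz: "x \<in> V1 m" "y \<in> V1 n" "z \<in> V1 p"
    proof -
      let ?u = "b1 m (n + p) x (b1 n p y z)" and ?v = "b1 (m + n) p (b1 m n x y) z"
        and ?w = "b1 n (m + p) y (b1 m p x z)" and ?k = "m + n + p"
      have k: "m + (n + p) = ?k" "n + (m + p) = ?k" by simp_all
      have mems: "?u \<in> V1 ?k" "?v \<in> V1 ?k" "?w \<in> V1 ?k"
        using xyz closed[of x m "b1 n p y z" "n + p"] closed[of y n "b1 m p x z" "m + p"]
        by (simp_all add: closed k)
      have es: "e t ?k ?u = b2 m (n + p) (e t m x) (b2 n p (e t n y) (e t p z))"
        "e t ?k ?v = b2 (m + n) p (b2 m n (e t m x) (e t n y)) (e t p z)"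
        "e t ?k ?w = b2 n (m + p) (e t n y) (b2 m p (e t m x) (e t p z))" for t
        using xyz e_bracket[of x m "b1 n p y z" "n + p" t] e_bracket[of y n "b1 m p x z" "m + p" t]
        by (simp_all add: closed e_bracket k)
      show ?thesis
        using mems
        by (intro inj[of _ ?k])
          (simp_all add: S.subspace_add S.subspace_scale source(2) e es
            L.jacobi[OF e_mem[OF xyz(1)] e_mem[OF xyz(2)] e_mem[OF xyz(3)]])
    qed
  qed (use source closed in auto)
qed

text \<open>
  The hypothesis on \<open>0\<close> makes the formula correct outside the support of \<open>x\<close>.
\<close>

lemma lookup_extend_map:
  assumes "\<And>n. f n 0 = 0"
  shows "Poly_Mapping.lookup (extend_map f x) n = f n (Poly_Mapping.lookup x n)"
  using assms
  by (simp add: extend_map_def lookup_sum lookup_single when_def not_in_keys_iff_lookup_eq_zero)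

lemma graded_lie_morphism_extend_map:
  assumes source: "degreewise_lie_algebra scale1 V1 b1"
    and target: "degreewise_lie_algebra scale2 V2 b2"
    and linear: "\<And>n. Vector_Spaces.linear scale1 scale2 (f n)"
    and mem: "\<And>n x. x \<in> V1 n \<Longrightarrow> f n x \<in> V2 n"
    and bracket: "\<And>m n x y. \<lbrakk>x \<in> V1 m; y \<in> V1 n\<rbrakk> \<Longrightarrow>
      f (m + n) (b1 m n x y) = b2 m n (f m x) (f n y)"
  shows "graded_lie_morphism scale1 V1 (extend_bracket b1) scale2 V2 (extend_bracket b2) (extend_map f)"
proof -
  interpret L1: degreewise_lie_algebra scale1 V1 b1 by fact
  interpret L2: degreewise_lie_algebra scale2 V2 b2 by fact
  interpret G1: graded_lie_algebra scale1 V1 "extend_bracket b1" by (rule L1.graded_lie_algebra)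
  interpret G2: graded_lie_algebra scale2 V2 "extend_bracket b2" by (rule L2.graded_lie_algebra)
  have hom: "module_hom scale1 scale2 (f n)" for n
    using linear by (rule Vector_Spaces.linear.axioms(3))
  note f = module_hom.zero[OF hom] module_hom.add[OF hom] module_hom.scale[OF hom]
    module_hom.sum[OF hom]
  note lookup = lookup_extend_map[of f, OF f(1)] lookup_add lookup_dscale lookup_sum
  have single: "extend_map f (Poly_Mapping.single n v) = Poly_Mapping.single n (f n v)" for n v
    by (rule poly_mapping_eqI) (simp add: lookup f lookup_single when_def)
  have sum: "extend_map f (sum g I) = (\<Sum>i\<in>I. extend_map f (g i))" for g and I :: "nat set"
    by (rule poly_mapping_eqI) (simp add: lookup f)
  show ?thesis
  proof
    fix x y n c
    show "extend_map f (x + y) = extend_map f x + extend_map f y"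
      by (rule poly_mapping_eqI) (simp add: lookup f)
    show "extend_map f (dscale scale1 c x) = dscale scale2 c (extend_map f x)"
      by (rule poly_mapping_eqI) (simp add: lookup f)
    show "extend_map f x \<in> homogeneous V2 n" if "x \<in> homogeneous V1 n"
      using that by (auto simp: homogeneous_def single mem)
    show "extend_map f (extend_bracket b1 x y) = extend_bracket b2 (extend_map f x) (extend_map f y)"
      if xy: "x \<in> direct_sum V1" "y \<in> direct_sum V1"
    proof -
      have keys: "Poly_Mapping.keys (extend_map f z) \<subseteq> Poly_Mapping.keys z" for z
        by (auto simp: in_keys_iff lookup f)
      have "extend_bracket b2 (extend_map f x) (extend_map f y) =
          (\<Sum>m\<in>Poly_Mapping.keys x. \<Sum>n\<in>Poly_Mapping.keys y. Poly_Mapping.single (m + n)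
            (b2 m n (f m (Poly_Mapping.lookup x m)) (f n (Poly_Mapping.lookup y n))))"
        using keys xy mem
        by (subst L2.extend_bracket_eq_sum[of _ _ "Poly_Mapping.keys x" "Poly_Mapping.keys y"])
          (auto simp: direct_sum_def lookup f)
      also have "\<dots> = extend_map f (extend_bracket b1 x y)"
        using xy unfolding extend_bracket_def
        by (simp add: sum single bracket direct_sum_def)
      finally show ?thesis ..
    qed
  qed
qed

section \<open>Insertion of cochains\<close>

text \<open>
  With positions counted from \<open>0\<close>, the partial composition \<open>f \<circ>\<^sub>i g\<close> for \<open>g\<close> of arity \<open>k\<close> is
  \<open>f \<circ> insert_at i k g\<close>. Separating this operation on argument lists from \<open>f\<close> reduces the
  associativity laws of partial composition to identities between lists.
\<close>

definition insert_at :: "nat \<Rightarrow> nat \<Rightarrow> 'a cochain \<Rightarrow> 'a list \<Rightarrow> 'a list" where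
  "insert_at i k g as = take i as @ g (take k (drop i as)) # drop (i + k) as"

lemma insert_at_append_left:
  "i + k \<le> length us \<Longrightarrow> insert_at i k g (us @ ws) = insert_at i k g us @ ws"
  by (simp add: insert_at_def)

lemma insert_at_append_right:
  "insert_at (length us + i) k g (us @ ws) = us @ insert_at i k g ws"
  by (simp add: insert_at_def)

lemma insert_at_block:
  "length us = i \<Longrightarrow> length ws = k \<Longrightarrow> insert_at i k g (us @ ws @ vs) = us @ g ws # vs"
  by (simp add: insert_at_def)

lemma length_insert_at: "i + k \<le> length as \<Longrightarrow> length (insert_at i k g as) = length as + 1 - k"
  by (simp add: insert_at_def)

text \<open>
  The position \<open>i + j\<close> with \<open>j \<le> n\<close> falls into the block of arguments consumed by \<open>g\<close>, so the two
  insertions amount to a single one, of \<open>g \<circ>\<^sub>j h\<close>.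
\<close>

lemma insert_at_nested:
  assumes "i + (n + p + 1) \<le> length as" and "j \<le> n"
  shows "insert_at i (n + 1) g (insert_at (i + j) (p + 1) h as) =
    insert_at i (n + p + 1) (\<lambda>bs. g (insert_at j (p + 1) h bs)) as"
proof -
  obtain us ws vs where as: "as = us @ ws @ vs" "length us = i" "length ws = n + p + 1"
  proof
    show "as = take i as @ take (n + p + 1) (drop i as) @ drop (n + p + 1) (drop i as)"
      by (simp only: append_take_drop_id)
  qed (use assms(1) in auto)
  have "insert_at (i + j) (p + 1) h as = us @ insert_at j (p + 1) h ws @ vs"
    using as assms(2) insert_at_append_right[of us j "p + 1" h "ws @ vs"]
    by (simp add: insert_at_append_left)
  moreover have "length (insert_at j (p + 1) h ws) = n + 1"
    using as assms(2) by (simp add: length_insert_at)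
  ultimately show ?thesis
    using as by (simp add: insert_at_block del: append.simps)
qed

text \<open>
  Insertions into disjoint blocks commute. Inserting \<open>h\<close> to the left of \<open>g\<close> replaces \<open>p + 1\<close>
  arguments by one, hence the shift of the position of \<open>g\<close> by \<open>p\<close>.
\<close>

lemma insert_at_parallel:
  assumes "l < i" and "i + p + n + 1 \<le> length as"
  shows "insert_at i (n + 1) g (insert_at l (p + 1) h as) =
    insert_at l (p + 1) h (insert_at (i + p) (n + 1) g as)"
proof -
  obtain us ws where as: "as = us @ ws" "length us = i + p"
  proof
    show "as = take (i + p) as @ drop (i + p) as" by simp
  qed (use assms(2) in auto)
  have len: "length (insert_at l (p + 1) h us) = i"
    using as assms(1) by (simp add: length_insert_at)
  have "insert_at i (n + 1) g (insert_at l (p + 1) h us @ ws) =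
      insert_at l (p + 1) h us @ insert_at 0 (n + 1) g ws"
    using insert_at_append_right[of "insert_at l (p + 1) h us" 0 "n + 1" g ws] len by simp
  moreover have "insert_at (i + p) (n + 1) g as = us @ insert_at 0 (n + 1) g ws"
    using insert_at_append_right[of us 0 "n + 1" g ws] as by simp
  ultimately show ?thesis
    using as assms(1) by (simp add: insert_at_append_left)
qed

section \<open>The Gerstenhaber bracket\<close>

text \<open>
  The terms of \<open>(f \<diamond> g) \<diamond> h\<close> in which \<open>h\<close> occupies an argument of \<open>f\<close> to the left of \<open>g\<close>.
\<close>

definition disjoint_insertions ::
    "('k::field \<Rightarrow> 'a::ab_group_add \<Rightarrow> 'a) \<Rightarrow> nat \<Rightarrow> nat \<Rightarrow> nat
      \<Rightarrow> 'a cochain \<Rightarrow> 'a cochain \<Rightarrow> 'a cochain \<Rightarrow> 'a list \<Rightarrow> 'a" where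
  "disjoint_insertions scale m n p f g h as = (\<Sum>i\<le>m. \<Sum>l<i.
    scale ((-1) ^ (i * n + l * p)) (f (insert_at i (n + 1) g (insert_at l (p + 1) h as))))"

context vector_space
begin

lemma cochains_linear_slot:
  assumes f: "f \<in> cochains scale n" and len: "length us + length vs + 1 = n"
  shows "Vector_Spaces.linear scale scale (\<lambda>x. f (us @ x # vs))"
proof -
  have "Vector_Spaces.linear scale scale (\<lambda>x. f ((us @ undefined # vs)[length us := x]))"
  proof -
    \<comment> \<open>The element \<open>undefined\<close> only fills the slot that the update overwrites.\<close>
    have "length (us @ undefined # vs) = n" "length us < n" using len by auto
    then show ?thesis using f unfolding cochains_def by blast
  qed
  then show ?thesis by simp
qed

lemma cochains_eq_0: "f \<in> cochains scale n \<Longrightarrow> length as \<noteq> n \<Longrightarrow> f as = 0"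
  by (simp add: cochains_def)

lemma cochainsI:
  assumes "\<And>as. length as \<noteq> n \<Longrightarrow> f as = 0"
    and slot: "\<And>us vs. length us + length vs + 1 = n \<Longrightarrow>
      Vector_Spaces.linear scale scale (\<lambda>x. f (us @ x # vs))"
  shows "f \<in> cochains scale n"
  unfolding cochains_def
proof (intro CollectI conjI allI impI)
  fix as :: "'b list" and i assume "length as = n" "i < n"
  then show "Vector_Spaces.linear scale scale (\<lambda>x. f (as[i := x]))"
    using slot[of "take i as" "drop (Suc i) as"] by (simp add: upd_conv_take_nth_drop)
qed (fact assms(1))

lemma cochains_sum_slot:
  assumes f: "f \<in> cochains scale n" and len: "length us + length vs + 1 = n"
  shows "f (us @ (\<Sum>i\<in>I. scale (c i) (x i)) # vs) = (\<Sum>i\<in>I. scale (c i) (f (us @ x i # vs)))"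
proof -
  interpret module_hom scale scale "\<lambda>x. f (us @ x # vs)"
    using cochains_linear_slot[OF assms] by (rule Vector_Spaces.linear.axioms(3))
  show ?thesis using sum[of "\<lambda>i. scale (c i) (x i)" I] by (simp add: scale)
qed

lemma vector_space_cochain_scale: "vector_space (cochain_scale scale)"
  by unfold_locales
    (simp_all add: cochain_scale_def fun_eq_iff scale_right_distrib scale_left_distrib)

lemma subspace_cochains: "module.subspace (cochain_scale scale) (cochains scale n)"
proof -
  interpret C: vector_space "cochain_scale scale" by (rule vector_space_cochain_scale)
  interpret P: vector_space_pair scale scale ..
  show ?thesis
    unfolding C.subspace_def
    by (auto intro!: cochainsI P.linear_zero P.linear_compose_add P.linear_compose_scale_right
        simp: cochains_eq_0 cochain_scale_def cochains_linear_slot)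
qed

lemma gerst_circ_eq_sum:
  assumes "length as = m + n + 1"
  shows "gerst_circ scale m n f g as =
    (\<Sum>i\<le>m. scale ((-1) ^ (i * n)) (f (insert_at i (n + 1) g as)))"
  using assms
  by (simp add: gerst_circ_def insert_at_def sum.atLeast_Suc_atMost_Suc_shift atLeast0AtMost
      del: sum.cl_ivl_Suc)

lemma gerst_circ_eq_0: "length as \<noteq> m + n + 1 \<Longrightarrow> gerst_circ scale m n f g as = 0"
  by (simp add: gerst_circ_def)

text \<open>
  A given argument of \<open>f \<circ>\<^sub>i g\<close> lies to the right of the block consumed by \<open>g\<close>, inside it, or to its
  left. In the outer cases it is a slot of \<open>f\<close>; inside the block it enters through a slot of \<open>g\<close>
  followed by one of \<open>f\<close>.
\<close>

lemma gerst_circ_mem: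
  assumes f: "f \<in> cochains scale (m + 1)" and g: "g \<in> cochains scale (n + 1)"
  shows "gerst_circ scale m n f g \<in> cochains scale (m + n + 1)"
proof (rule cochainsI)
  interpret P: vector_space_pair scale scale ..
  fix us vs :: "'b list"
  assume len: "length us + length vs + 1 = m + n + 1"
  have "Vector_Spaces.linear scale scale (\<lambda>x. f (insert_at i (n + 1) g (us @ x # vs)))"
    if i: "i \<le> m" for i
  proof -
    consider "i + (n + 1) \<le> length us" | "i \<le> length us" "length us < i + (n + 1)" | "length us < i"
      by linarith
    then show ?thesis
    proof cases
      case 1
      then show ?thesis
        using cochains_linear_slot[OF f, of "insert_at i (n + 1) g us" vs] len
        by (simp add: insert_at_append_left length_insert_at)
    next
      case 2
      let ?j = "i + n - length us"
      have "Vector_Spaces.linear scale scale (\<lambda>x. g (drop i us @ x # take ?j vs))"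
        using 2 len i by (intro cochains_linear_slot[OF g]) auto
      moreover have "Vector_Spaces.linear scale scale (\<lambda>y. f (take i us @ y # drop ?j vs))"
        using 2 len i by (intro cochains_linear_slot[OF f]) auto
      ultimately have "Vector_Spaces.linear scale scale
          ((\<lambda>y. f (take i us @ y # drop ?j vs)) \<circ> (\<lambda>x. g (drop i us @ x # take ?j vs)))"
        by (rule Vector_Spaces.linear_compose)
      moreover have "insert_at i (n + 1) g (us @ x # vs) =
          take i us @ g (drop i us @ x # take ?j vs) # drop ?j vs" for x
      proof -
        have eq: "us @ x # vs = take i us @ (drop i us @ x # take ?j vs) @ drop ?j vs" by simp
        show ?thesis
          using 2 len i by (subst eq, intro insert_at_block) auto
      qed
      ultimately show ?thesis by (simp add: o_def)
    next
      case 3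
      then obtain j where j: "i = Suc (length us) + j" using less_natE by (metis add_Suc_shift add_Suc)
      have "insert_at i (n + 1) g (us @ x # vs) = us @ x # insert_at j (n + 1) g vs" for x
        using insert_at_append_right[of "us @ [x]" j "n + 1" g vs] j by simp
      then show ?thesis
        using cochains_linear_slot[OF f, of us "insert_at j (n + 1) g vs"] len i j
        by (simp add: length_insert_at)
    qed
  qed
  then have "Vector_Spaces.linear scale scale
      (\<lambda>x. \<Sum>i\<le>m. scale ((-1) ^ (i * n)) (f (insert_at i (n + 1) g (us @ x # vs))))"
    by (intro P.linear_compose_sum ballI P.linear_compose_scale_right) auto
  then show "Vector_Spaces.linear scale scale (\<lambda>x. gerst_circ scale m n f g (us @ x # vs))"
    using len by (simp add: gerst_circ_eq_sum)
qed (rule gerst_circ_eq_0)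

lemma gerst_circ_linear_left:
  "Vector_Spaces.linear (cochain_scale scale) (cochain_scale scale) (\<lambda>f. gerst_circ scale m n f g)"
  unfolding Vector_Spaces.linear_iff using vector_space_cochain_scale
  by (auto simp: fun_eq_iff gerst_circ_def cochain_scale_def scale_right_distrib sum.distrib
      scale_sum_right mult.commute simp del: sum.cl_ivl_Suc)

lemma gerst_circ_linear_right:
  assumes f: "f \<in> cochains scale (m + 1)"
  shows "Vector_Spaces.linear (cochain_scale scale) (cochain_scale scale) (\<lambda>g. gerst_circ scale m n f g)"
proof -
  have slot: "Vector_Spaces.linear scale scale (\<lambda>x. f (take i as @ x # drop (i + (n + 1)) as))"
    if "length as = m + n + 1" "i \<le> m" for as i
    using that by (intro cochains_linear_slot[OF f]) auto
  have "gerst_circ scale m n f (g + h) as = gerst_circ scale m n f g as + gerst_circ scale m n f h as" for g h as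
    using slot by (cases "length as = m + n + 1")
      (simp_all add: gerst_circ_eq_sum gerst_circ_eq_0 insert_at_def Vector_Spaces.linear_iff sum.distrib
        scale_right_distrib)
  moreover have "gerst_circ scale m n f (cochain_scale scale c g) as = scale c (gerst_circ scale m n f g as)" for c g as
    using slot by (cases "length as = m + n + 1")
      (simp_all add: gerst_circ_eq_sum gerst_circ_eq_0 insert_at_def Vector_Spaces.linear_iff cochain_scale_def
        scale_sum_right mult.commute)
  ultimately show ?thesis
    using vector_space_cochain_scale by (auto simp: Vector_Spaces.linear_iff cochain_scale_def)
qed

text \<open>
  In \<open>(f \<diamond> g) \<diamond> h\<close> let \<open>g\<close> be inserted at \<open>i\<close> and \<open>h\<close> at \<open>l\<close>. The terms with \<open>i \<le> l \<le> i + n\<close>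
  are nested and add up to \<open>f \<diamond> (g \<diamond> h)\<close>, by linearity of \<open>f\<close>. Those with \<open>l < i\<close> have \<open>h\<close> to the
  left of \<open>g\<close>. Those with \<open>l = j + n\<close> and \<open>j > i\<close> have \<open>g\<close> to the left of \<open>h\<close>; their sign exponent
  \<open>i n + (j + n) p\<close> exceeds the one for the exchanged roles by \<open>n p\<close>. The right hand side is thus
  symmetric in \<open>g\<close> and \<open>h\<close> up to the sign \<open>(-1)\<^sup>n\<^sup>p\<close>.
\<close>

lemma gerst_circ_associator:
  assumes f: "f \<in> cochains scale (m + 1)" and len: "length as = m + n + p + 1"
  shows "gerst_circ scale (m + n) p (gerst_circ scale m n f g) h as -
      gerst_circ scale m (n + p) f (gerst_circ scale n p g h) as =
    disjoint_insertions scale m n p f g h as +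
      scale ((-1) ^ (n * p)) (disjoint_insertions scale m p n f h g as)"
proof -
  define T where "T i l = scale ((-1) ^ (i * n + l * p))
    (f (insert_at i (n + 1) g (insert_at l (p + 1) h as)))" for i l
  have "gerst_circ scale (m + n) p (gerst_circ scale m n f g) h as = (\<Sum>l\<le>m + n. \<Sum>i\<le>m. T i l)"
    using len
    by (simp add: gerst_circ_eq_sum length_insert_at T_def scale_sum_right power_add mult.commute)
  also have "\<dots> = (\<Sum>i\<le>m. \<Sum>l\<le>m + n. T i l)" by (rule sum.swap)
  also have "\<dots> = (\<Sum>i\<le>m. (\<Sum>l<i. T i l) + (\<Sum>j\<le>n. T i (i + j)) + (\<Sum>j=Suc i..m. T i (j + n)))"
  proof (rule sum.cong[OF refl])
    fix i assume "i \<in> {..m}"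
    then have "{..m + n} = {..<i} \<union> ({0 + i..n + i} \<union> {Suc i + n..m + n})" by auto
    then have "(\<Sum>l\<le>m + n. T i l) = (\<Sum>l<i. T i l) + (sum (T i) {0 + i..n + i} + sum (T i) {Suc i + n..m + n})"
      by (simp only:) (subst sum.union_disjoint, auto)+
    also have "sum (T i) {0 + i..n + i} = (\<Sum>j\<le>n. T i (i + j))"
      unfolding sum.shift_bounds_cl_nat_ivl by (simp add: atLeast0AtMost add.commute)
    also have "sum (T i) {Suc i + n..m + n} = (\<Sum>j=Suc i..m. T i (j + n))"
      by (rule sum.shift_bounds_cl_nat_ivl)
    finally show "(\<Sum>l\<le>m + n. T i l) =
        (\<Sum>l<i. T i l) + (\<Sum>j\<le>n. T i (i + j)) + (\<Sum>j=Suc i..m. T i (j + n))"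
      by (simp add: add.assoc)
  qed
  also have "\<dots> = (\<Sum>i\<le>m. \<Sum>l<i. T i l) + (\<Sum>i\<le>m. \<Sum>j\<le>n. T i (i + j)) + (\<Sum>i\<le>m. \<Sum>j=Suc i..m. T i (j + n))"
    by (simp add: sum.distrib)
  also have "(\<Sum>i\<le>m. \<Sum>l<i. T i l) = disjoint_insertions scale m n p f g h as"
    by (simp add: disjoint_insertions_def T_def)
  also have "(\<Sum>i\<le>m. \<Sum>j\<le>n. T i (i + j)) = gerst_circ scale m (n + p) f (gerst_circ scale n p g h) as"
  proof -
    have "f (insert_at i (n + p + 1) (gerst_circ scale n p g h) as) =
        (\<Sum>j\<le>n. scale ((-1) ^ (j * p)) (f (insert_at i (n + 1) g (insert_at (i + j) (p + 1) h as))))"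
      if "i \<le> m" for i
    proof -
      have "f (insert_at i (n + p + 1) (gerst_circ scale n p g h) as) =
          f (take i as @ (\<Sum>j\<le>n. scale ((-1) ^ (j * p))
            (g (insert_at j (p + 1) h (take (n + p + 1) (drop i as))))) # drop (i + (n + p + 1)) as)"
        using that len by (simp add: insert_at_def gerst_circ_eq_sum)
      also have "\<dots> = (\<Sum>j\<le>n. scale ((-1) ^ (j * p))
          (f (insert_at i (n + p + 1) (\<lambda>bs. g (insert_at j (p + 1) h bs)) as)))"
        using that len by (subst cochains_sum_slot[OF f]) (auto simp: insert_at_def[of i])
      also have "\<dots> = (\<Sum>j\<le>n. scale ((-1) ^ (j * p))
          (f (insert_at i (n + 1) g (insert_at (i + j) (p + 1) h as))))"
        using that len by (intro sum.cong refl) (subst insert_at_nested, auto)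
      finally show ?thesis .
    qed
    then show ?thesis
      using len by (simp add: gerst_circ_eq_sum T_def scale_sum_right power_add algebra_simps)
  qed
  also have "(\<Sum>i\<le>m. \<Sum>j=Suc i..m. T i (j + n)) =
      scale ((-1) ^ (n * p)) (disjoint_insertions scale m p n f h g as)"
  proof -
    have "(\<Sum>i\<le>m. \<Sum>j=Suc i..m. T i (j + n)) = (\<Sum>i<m. \<Sum>j=Suc i..m. T i (j + n))"
      by (simp flip: lessThan_Suc_atMost)
    also have "\<dots> = (\<Sum>j\<le>m. \<Sum>i<j. T i (j + n))" by (rule sum.nested_swap'[symmetric])
    also have "\<dots> = (\<Sum>j\<le>m. \<Sum>i<j. scale ((-1) ^ (n * p)) (scale ((-1) ^ (j * p + i * n))
        (f (insert_at j (p + 1) h (insert_at i (n + 1) g as)))))"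
    proof (intro sum.cong refl)
      fix j i assume "j \<in> {..m}" "i \<in> {..<j}"
      then have "insert_at j (p + 1) h (insert_at i (n + 1) g as) =
          insert_at i (n + 1) g (insert_at (j + n) (p + 1) h as)"
        using len by (intro insert_at_parallel) auto
      then show "T i (j + n) = scale ((-1) ^ (n * p)) (scale ((-1) ^ (j * p + i * n))
          (f (insert_at j (p + 1) h (insert_at i (n + 1) g as))))"
        by (simp add: T_def power_add algebra_simps)
    qed
    finally show ?thesis by (simp add: disjoint_insertions_def scale_sum_right)
  qed
  finally show ?thesis by simp
qed

text \<open>
  The symmetry of the associator in its last two arguments, solved for \<open>(f \<diamond> g) \<diamond> h\<close> so that it can
  serve as a rewrite rule in the proof of the Jacobi identity.
\<close>

lemma gerst_circ_pre_lie:
  assumes f: "f \<in> cochains scale (m + 1)"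
  shows "gerst_circ scale (m + n) p (gerst_circ scale m n f g) h =
    gerst_circ scale m (n + p) f (gerst_circ scale n p g h) +
    cochain_scale scale ((-1) ^ (n * p))
      (gerst_circ scale (m + p) n (gerst_circ scale m p f h) g -
       gerst_circ scale m (n + p) f (gerst_circ scale p n h g))"
proof
  fix as
  show "gerst_circ scale (m + n) p (gerst_circ scale m n f g) h as =
    (gerst_circ scale m (n + p) f (gerst_circ scale n p g h) +
     cochain_scale scale ((-1) ^ (n * p))
      (gerst_circ scale (m + p) n (gerst_circ scale m p f h) g -
       gerst_circ scale m (n + p) f (gerst_circ scale p n h g))) as"
  proof (cases "length as = m + n + p + 1")
    case True
    let ?e = "(-1) ^ (n * p) :: 'a"
    let ?D = "disjoint_insertions scale m n p f g h as"
      and ?D' = "disjoint_insertions scale m p n f h g as"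
    have "?e * ?e = 1" by (simp flip: power_mult_distrib)
    moreover have "gerst_circ scale (m + p) n (gerst_circ scale m p f h) g as -
        gerst_circ scale m (n + p) f (gerst_circ scale p n h g) as = ?D' + scale ?e ?D"
      using gerst_circ_associator[OF f, of as p n h g] True by (simp add: add_ac mult.commute)
    ultimately show ?thesis
      using gerst_circ_associator[OF f True, of g h]
      by (simp add: cochain_scale_def scale_right_distrib algebra_simps)
  qed (simp add: gerst_circ_eq_0 cochain_scale_def)
qed

text \<open>
  Expanding all brackets gives twelve iterated compositions. The pre-Lie identity eliminates
  \<open>(f \<diamond> g) \<diamond> h\<close>, \<open>(g \<diamond> f) \<diamond> h\<close> and \<open>(h \<diamond> f) \<diamond> g\<close>, after which the remaining terms cancel; the signs are
  settled by the parities of \<open>m\<close>, \<open>n\<close> and \<open>p\<close>.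
\<close>

lemma gerst_bracket_jacobi:
  assumes f: "f \<in> cochains scale (m + 1)" and g: "g \<in> cochains scale (n + 1)"
    and h: "h \<in> cochains scale (p + 1)"
  shows "gerst_bracket scale m (n + p) f (gerst_bracket scale n p g h) =
    gerst_bracket scale (m + n) p (gerst_bracket scale m n f g) h +
    cochain_scale scale ((-1) ^ (m * n))
      (gerst_bracket scale n (m + p) g (gerst_bracket scale m p f h))"
proof -
  interpret C: vector_space "cochain_scale scale" by (rule vector_space_cochain_scale)
  have left: "gerst_circ scale k l (u - v) w = gerst_circ scale k l u w - gerst_circ scale k l v w"
    "gerst_circ scale k l (cochain_scale scale c u) w = cochain_scale scale c (gerst_circ scale k l u w)"
    for k l u v w c
    using module_hom.diff[OF Vector_Spaces.linear.axioms(3)[OF gerst_circ_linear_left]]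
      module_hom.scale[OF Vector_Spaces.linear.axioms(3)[OF gerst_circ_linear_left]] by auto
  have right: "gerst_circ scale k l u (v - w) = gerst_circ scale k l u v - gerst_circ scale k l u w"
    "gerst_circ scale k l u (cochain_scale scale c v) = cochain_scale scale c (gerst_circ scale k l u v)"
    if "u \<in> cochains scale (k + 1)" for k l u v w c
    using module_hom.diff[OF Vector_Spaces.linear.axioms(3)[OF gerst_circ_linear_right[OF that]]]
      module_hom.scale[OF Vector_Spaces.linear.axioms(3)[OF gerst_circ_linear_right[OF that]]] by auto
  note pl = gerst_circ_pre_lie[OF f, of n p g h] gerst_circ_pre_lie[OF g, of m p f h]
    gerst_circ_pre_lie[OF h, of m n f g]
  note comm = add.commute[of p m] add.commute[of p n] add.commute[of n m]
  show ?thesis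
    unfolding gerst_bracket_def left right[OF f] right[OF g] right[OF h] comm pl[unfolded comm]
    by (cases "even m"; cases "even n"; cases "even p")
      (simp_all add: minus_one_power_iff C.scale_right_diff_distrib)
qed

lemma gerst_degreewise_lie_algebra:
  "degreewise_lie_algebra (cochain_scale scale) (gerst_component scale) (gerst_bracket scale)"
proof -
  interpret C: vector_space "cochain_scale scale" by (rule vector_space_cochain_scale)
  note left = gerst_circ_linear_left[unfolded Vector_Spaces.linear_iff]
    and right = gerst_circ_linear_right[unfolded Vector_Spaces.linear_iff]
  show ?thesis
    unfolding gerst_component_def
  proof
    fix m n p f f' g h and c :: 'a
    show "C.subspace (cochains scale (n + 1))" by (rule subspace_cochains)
    assume f: "f \<in> cochains scale (m + 1)" and g: "g \<in> cochains scale (n + 1)"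
    show "gerst_bracket scale m n f g \<in> cochains scale (m + n + 1)"
      using gerst_circ_mem[OF f g] gerst_circ_mem[OF g f]
      by (auto simp: gerst_bracket_def add.commute[of n m]
          intro!: C.subspace_diff C.subspace_scale subspace_cochains)
    show "gerst_bracket scale m n (f + f') g = gerst_bracket scale m n f g + gerst_bracket scale m n f' g"
      using left right[OF g] by (simp add: gerst_bracket_def C.scale_right_distrib)
    show "gerst_bracket scale m n (cochain_scale scale c f) g = cochain_scale scale c (gerst_bracket scale m n f g)"
      using left right[OF g]
      by (simp add: gerst_bracket_def C.scale_right_diff_distrib mult.commute)
    have "(-1) ^ (m * n) * (-1) ^ (m * n) = (1 :: 'a)" by (simp flip: power_mult_distrib)
    then show "gerst_bracket scale m n f g = - cochain_scale scale ((-1) ^ (m * n)) (gerst_bracket scale n m g f)"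
      by (simp add: gerst_bracket_def C.scale_right_diff_distrib mult.commute[of n m])
    show "gerst_bracket scale m (n + p) f (gerst_bracket scale n p g h) =
        gerst_bracket scale (m + n) p (gerst_bracket scale m n f g) h +
        cochain_scale scale ((-1) ^ (m * n)) (gerst_bracket scale n (m + p) g (gerst_bracket scale m p f h))"
      if "h \<in> cochains scale (p + 1)"
      using f g that by (rule gerst_bracket_jacobi)
  qed
qed

section \<open>The compatible bracket and evaluation of polynomials\<close>

text \<open>
  Taking coordinates with respect to a basis reduces the claim to scalar polynomials, which have
  only finitely many roots unless they vanish.
\<close>

lemma polynomial_coefficients_eq_0:
  assumes inf: "infinite (UNIV :: 'a set)"
    and zero: "\<And>t. (\<Sum>k\<le>n. scale (t ^ k) (v k)) = 0" and k: "k \<le> n"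
  shows "v k = 0"
proof -
  define B where "B = extend_basis {}"
  have B: "independent B" "span B = UNIV"
    unfolding B_def by (simp_all add: independent_extend_basis independent_empty)
  have "representation B (v k) b = 0" for b
  proof -
    define p where "p = (\<Sum>j\<le>n. monom (representation B (v j) b) j)"
    have "poly p t = 0" for t
    proof -
      have "poly p t = representation B (\<Sum>j\<le>n. scale (t ^ j) (v j)) b"
        using B by (simp add: p_def poly_sum poly_monom representation_sum representation_scale mult.commute)
      then show ?thesis by (simp add: zero representation_zero)
    qed
    then have "p = 0" using poly_roots_finite[of p] inf by auto
    then have "coeff p k = 0" by simp
    then show ?thesis using k by (simp add: p_def coeff_sum)
  qed
  then show ?thesis using sum_nonzero_representation_eq[OF B(1), of "v k"] B(2) by simp
qed

end

text \<open>
  The value at \<open>t\<close> of the polynomial \<open>F 1 + t F 2 + \<dots> + t\<^sup>n F (n + 1)\<close>; the entry with index \<open>i\<close> is the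
  coefficient of \<open>t\<^sup>i\<^sup>-\<^sup>1\<close>.
\<close>

definition eval_tuple ::
    "('k::field \<Rightarrow> 'a::ab_group_add \<Rightarrow> 'a) \<Rightarrow> 'k \<Rightarrow> nat \<Rightarrow> 'a cochain_tuple \<Rightarrow> 'a cochain" where
  "eval_tuple scale t n F = (\<Sum>i = 1..n + 1. cochain_scale scale (t ^ (i - 1)) (F i))"

context vector_space
begin

lemma eval_tuple_apply: "eval_tuple scale t n F as = (\<Sum>k\<le>n. scale (t ^ k) (F (Suc k) as))"
proof -
  have "(sum f I) as = (\<Sum>i\<in>I. f i as)" for f :: "nat \<Rightarrow> 'b cochain" and I
    by (induction I rule: infinite_finite_induct) auto
  then show ?thesis
    by (simp add: eval_tuple_def cochain_scale_def sum.atLeast_Suc_atMost_Suc_shift atLeast0AtMost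
        del: sum.cl_ivl_Suc)
qed

lemma eval_tuple_1: "eval_tuple scale 1 = tuple_sum"
  by (simp add: fun_eq_iff eval_tuple_def tuple_sum_def cochain_scale_def)

lemma vector_space_tuple_scale: "vector_space (tuple_scale scale)"
  by unfold_locales
    (simp_all add: tuple_scale_def cochain_scale_def fun_eq_iff scale_right_distrib scale_left_distrib)

lemma eval_tuple_linear:
  "Vector_Spaces.linear (tuple_scale scale) (cochain_scale scale) (eval_tuple scale t n)"
  using vector_space_tuple_scale vector_space_cochain_scale
  by (simp add: Vector_Spaces.linear_iff fun_eq_iff eval_tuple_apply tuple_scale_def cochain_scale_def
      scale_right_distrib sum.distrib scale_sum_right mult.commute)

lemma eval_tuple_mem:
  assumes "F \<in> compat_component scale n"
  shows "eval_tuple scale t n F \<in> gerst_component scale n"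
proof -
  interpret C: vector_space "cochain_scale scale" by (rule vector_space_cochain_scale)
  show ?thesis
    using assms unfolding eval_tuple_def gerst_component_def compat_component_def
    by (blast intro: C.subspace_sum C.subspace_scale subspace_cochains)
qed

lemma eval_tuple_inject:
  assumes "infinite (UNIV :: 'a set)"
    and F: "F \<in> compat_component scale n" and G: "G \<in> compat_component scale n"
    and eq: "\<And>t. eval_tuple scale t n F = eval_tuple scale t n G"
  shows "F = G"
proof (intro ext)
  fix i as
  have "(\<Sum>k\<le>n. scale (t ^ k) (F (Suc k) as - G (Suc k) as)) = 0" for t
    using fun_cong[OF eq[of t], of as]
    by (simp add: eval_tuple_apply scale_right_diff_distrib sum_subtractf)
  from polynomial_coefficients_eq_0[OF assms(1) this]
  have "F (Suc k) as = G (Suc k) as" if "k \<le> n" for k using that by simp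
  then show "F i as = G i as"
    using F G by (cases "i \<in> {1..n + 1}"; cases i) (auto simp: compat_component_def)
qed

lemma subspace_compat_component: "module.subspace (tuple_scale scale) (compat_component scale n)"
proof -
  interpret C: vector_space "cochain_scale scale" by (rule vector_space_cochain_scale)
  interpret T: vector_space "tuple_scale scale" by (rule vector_space_tuple_scale)
  note C.subspace_0[OF subspace_cochains] C.subspace_add[OF subspace_cochains]
    C.subspace_scale[OF subspace_cochains]
  then show ?thesis
    by (auto simp: T.subspace_def compat_component_def tuple_scale_def)
qed

lemma compat_bracket_mem:
  assumes F: "F \<in> compat_component scale m" and G: "G \<in> compat_component scale n"
  shows "compat_bracket scale m n F G \<in> compat_component scale (m + n)"
proof -
  interpret L: degreewise_lie_algebra "cochain_scale scale" "gerst_component scale" "gerst_bracket scale"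
    by (rule gerst_degreewise_lie_algebra)
  have "compat_bracket scale m n F G i \<in> gerst_component scale (m + n)" for i
    using F G unfolding compat_bracket_def
    by (auto simp: compat_component_def gerst_component_def[symmetric, simplified]
        intro!: L.subspace_sum L.subspace L.closed)
  moreover have "compat_bracket scale m n F G i = 0" if "i \<notin> {1..m + n + 1}" for i
    using that unfolding compat_bracket_def by (intro sum.neutral) auto
  ultimately show ?thesis by (simp add: compat_component_def gerst_component_def)
qed

text \<open>
  Multiplicativity of evaluation: if \<open>q + r = i + 1\<close> then the exponents \<open>q - 1\<close> and \<open>r - 1\<close> add up to
  \<open>i - 1\<close>, and the fibres of \<open>(q, r) \<mapsto> q + r - 1\<close> partition all pairs of indices.
\<close>

lemma eval_tuple_compat_bracket:
  assumes F: "F \<in> compat_component scale m" and G: "G \<in> compat_component scale n"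
  shows "eval_tuple scale t (m + n) (compat_bracket scale m n F G) =
    gerst_bracket scale m n (eval_tuple scale t m F) (eval_tuple scale t n G)"
proof -
  interpret L: degreewise_lie_algebra "cochain_scale scale" "gerst_component scale" "gerst_bracket scale"
    by (rule gerst_degreewise_lie_algebra)
  let ?br = "\<lambda>q r. gerst_bracket scale m n (F q) (G r)"
  let ?h = "\<lambda>(q, r). cochain_scale scale (t ^ (q - 1 + (r - 1))) (?br q r)"
  let ?I = "{1..m + 1} \<times> {1..n + 1}"
  have FG: "F q \<in> gerst_component scale m" "G r \<in> gerst_component scale n"
    if "q \<in> {1..m + 1}" "r \<in> {1..n + 1}" for q r
    using F G that by (simp_all add: compat_component_def gerst_component_def)
  have "eval_tuple scale t (m + n) (compat_bracket scale m n F G) =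
      (\<Sum>i = 1..m + n + 1. \<Sum>x\<in>{x \<in> ?I. fst x + snd x - 1 = i}. ?h x)"
    unfolding eval_tuple_def compat_bracket_def
  proof (rule sum.cong[OF refl])
    fix i assume i: "i \<in> {1..m + n + 1}"
    have "{(q, r). q + r = i + 1 \<and> 1 \<le> q \<and> q \<le> m + 1 \<and> 1 \<le> r \<and> r \<le> n + 1} =
        {x \<in> ?I. fst x + snd x - 1 = i}" by auto
    then show "cochain_scale scale (t ^ (i - 1))
        (\<Sum>(q, r)\<in>{(q, r). q + r = i + 1 \<and> 1 \<le> q \<and> q \<le> m + 1 \<and> 1 \<le> r \<and> r \<le> n + 1}. ?br q r) =
        (\<Sum>x\<in>{x \<in> ?I. fst x + snd x - 1 = i}. ?h x)"
      by (auto simp: L.scale_sum_right intro!: sum.cong arg_cong2[of _ _ _ _ "cochain_scale scale"]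
          arg_cong2[of _ _ _ _ "(^)"])
  qed
  also have "\<dots> = (\<Sum>x\<in>?I. ?h x)"
    by (rule sum.group) auto
  also have "\<dots> = (\<Sum>q = 1..m + 1. cochain_scale scale (t ^ (q - 1))
      (\<Sum>r = 1..n + 1. cochain_scale scale (t ^ (r - 1)) (?br q r)))"
    by (simp only: sum.cartesian_product[symmetric] L.scale_sum_right L.scale_scale power_add)
  also have "\<dots> = (\<Sum>q = 1..m + 1. cochain_scale scale (t ^ (q - 1))
      (gerst_bracket scale m n (F q) (eval_tuple scale t n G)))"
    unfolding eval_tuple_def
    by (intro sum.cong refl arg_cong2[of _ _ _ _ "cochain_scale scale"] L.sum_right[symmetric]
        FG(1)[of _ 1] FG(2)[of 1]) auto
  also have "\<dots> = gerst_bracket scale m n (eval_tuple scale t m F) (eval_tuple scale t n G)"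
    unfolding eval_tuple_def[of scale t m F]
    by (intro L.sum_left[symmetric] FG(1)[of _ 1] eval_tuple_mem G) auto
  finally show ?thesis .
qed

lemma compat_degreewise_lie_algebra:
  assumes "infinite (UNIV :: 'a set)"
  shows "degreewise_lie_algebra (tuple_scale scale) (compat_component scale) (compat_bracket scale)"
  using gerst_degreewise_lie_algebra vector_space_tuple_scale subspace_compat_component
    compat_bracket_mem eval_tuple_mem eval_tuple_linear eval_tuple_compat_bracket
    eval_tuple_inject[OF assms]
  by (rule degreewise_lie_algebra_of_jointly_injective[where e = "eval_tuple scale"])

section \<open>Maurer-Cartan elements\<close>

text \<open>
  For binary cochains \<open>(f \<diamond> g) (a, b, c) = f (g (a, b), c) - f (a, g (b, c))\<close>, and the sign
  \<open>(-1)\<^sup>1\<close> in the bracket turns the difference of the two compositions into their sum. With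
  \<open>f = g\<close> the condition is twice the associative law, otherwise it is the compatibility law.
\<close>

lemma gerst_bracket_binary_eq_0_iff:
  "gerst_bracket scale 1 1 f g = 0 \<longleftrightarrow>
    (\<forall>a b c. g [f [a, b], c] + f [g [a, b], c] = f [a, g [b, c]] + g [a, f [b, c]])"
proof -
  have circ: "gerst_circ scale 1 1 p q [a, b, c] = p [q [a, b], c] - p [a, q [b, c]]" for p q a b c
    by (simp add: gerst_circ_eq_sum insert_at_def numeral_2_eq_2)
  have br: "gerst_bracket scale 1 1 f g [a, b, c] =
      g [f [a, b], c] + f [g [a, b], c] - (f [a, g [b, c]] + g [a, f [b, c]])" for a b c
    by (simp add: gerst_bracket_def cochain_scale_def circ[simplified])
  have "gerst_bracket scale 1 1 f g = 0 \<longleftrightarrow> (\<forall>a b c. gerst_bracket scale 1 1 f g [a, b, c] = 0)"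
  proof (intro iffI allI ext)
    fix as assume *: "\<forall>a b c. gerst_bracket scale 1 1 f g [a, b, c] = 0"
    show "gerst_bracket scale 1 1 f g as = 0 as"
    proof (cases "length as = 3")
      case True
      then obtain a b c where "as = [a, b, c]" by (auto simp: numeral_3_eq_3 length_Suc_conv)
      then show ?thesis using * by simp
    qed (simp add: gerst_bracket_def gerst_circ_eq_0 cochain_scale_def)
  qed simp
  then show ?thesis by (simp only: br right_minus_eq)
qed

lemma compat_bracket_pair_tuple:
  "compat_bracket scale 1 1 (pair_tuple f g) (pair_tuple f g) = (\<lambda>i.
    if i = 1 then gerst_bracket scale 1 1 f f
    else if i = 2 then gerst_bracket scale 1 1 f g + gerst_bracket scale 1 1 g f
    else if i = 3 then gerst_bracket scale 1 1 g g else 0)"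
proof
  fix i :: nat
  let ?P = "{(q, r). q + r = i + 1 \<and> 1 \<le> q \<and> q \<le> 1 + 1 \<and> 1 \<le> r \<and> r \<le> 1 + (1 :: nat)}"
  have "?P = (if i = 1 then {(1, 1)} else if i = 2 then {(1, 2), (2, 1)}
    else if i = 3 then {(2, 2)} else {})" by auto
  then show "compat_bracket scale 1 1 (pair_tuple f g) (pair_tuple f g) i =
    (if i = 1 then gerst_bracket scale 1 1 f f
    else if i = 2 then gerst_bracket scale 1 1 f g + gerst_bracket scale 1 1 g f
    else if i = 3 then gerst_bracket scale 1 1 g g else 0)"
    unfolding compat_bracket_def by (simp add: pair_tuple_def)
qed

lemma bilinear_product_of_cochain:
  assumes "f \<in> cochains scale 2"
  shows "bilinear_product scale (\<lambda>a b. f [a, b])"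
  using cochains_linear_slot[OF assms, of "[_]" "[]"] cochains_linear_slot[OF assms, of "[]" "[_]"]
  by (simp add: bilinear_product_def)

lemma double_eq_iff:
  fixes x y :: 'b
  assumes "(2 :: 'a) \<noteq> 0"
  shows "x + x = y + y \<longleftrightarrow> x = y"
proof -
  have "x + x = y + y \<longleftrightarrow> scale 2 x = scale 2 y"
    using scale_left_distrib[of 1 1] by simp
  then show ?thesis using assms by simp
qed

lemma compatible_associative_iff_maurer_cartan:
  assumes two: "(2 :: 'a) \<noteq> 0" and f: "f \<in> cochains scale 2" and g: "g \<in> cochains scale 2"
  shows "compatible_associative scale (\<lambda>a b. f [a, b]) (\<lambda>a b. g [a, b]) \<longleftrightarrow>
    maurer_cartan (compat_component scale) (extend_bracket (compat_bracket scale))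
      (Poly_Mapping.single 1 (pair_tuple f g))"
proof -
  let ?P = "pair_tuple f g" and ?br = "gerst_bracket scale 1 1"
  have P: "?P \<in> compat_component scale 1"
    using f g by (auto simp: compat_component_def pair_tuple_def numeral_2_eq_2)
  have self: "?br p p = 0 \<longleftrightarrow> (\<forall>a b c. p [p [a, b], c] = p [a, p [b, c]])" for p
    unfolding gerst_bracket_binary_eq_0_iff double_eq_iff[OF two] by simp
  have sym: "?br g f = ?br f g"
    by (simp add: gerst_bracket_def cochain_scale_def fun_eq_iff add.commute)
  have mixed: "?br f g + ?br g f = 0 \<longleftrightarrow> ?br f g = 0"
    unfolding sym using double_eq_iff[OF two, of _ 0] by (simp add: fun_eq_iff)
  have single_0: "Poly_Mapping.single k v = 0 \<longleftrightarrow> v = 0" for k :: nat and v :: "'b cochain_tuple"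
    by (metis lookup_single_eq lookup_zero single_zero)
  have triple_0: "(\<lambda>i :: nat. if i = 1 then u else if i = 2 then v else if i = 3 then w else 0) = 0 \<longleftrightarrow>
      u = 0 \<and> v = 0 \<and> w = 0" (is "?F = 0 \<longleftrightarrow> ?R") for u v w :: "'b cochain"
  proof
    assume "?F = 0"
    from fun_cong[OF this, of 1] fun_cong[OF this, of 2] fun_cong[OF this, of 3]
    show ?R by simp
  next
    assume ?R
    then show "?F = 0" by (intro ext) simp
  qed
  have "maurer_cartan (compat_component scale) (extend_bracket (compat_bracket scale))
      (Poly_Mapping.single 1 ?P) \<longleftrightarrow> compat_bracket scale 1 1 ?P ?P = 0"
    using P extend_compat_bracket_single[OF vector_space_axioms P P]
    by (auto simp: maurer_cartan_def homogeneous_def single_0)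
  also have "\<dots> \<longleftrightarrow> ?br f f = 0 \<and> ?br f g + ?br g f = 0 \<and> ?br g g = 0"
    unfolding compat_bracket_pair_tuple by (rule triple_0)
  also have "\<dots> \<longleftrightarrow> compatible_associative scale (\<lambda>a b. f [a, b]) (\<lambda>a b. g [a, b])"
    unfolding self mixed gerst_bracket_binary_eq_0_iff[of f g]
      compatible_associative_def associative_product_def
    using bilinear_product_of_cochain[OF f] bilinear_product_of_cochain[OF g] by blast
  finally show ?thesis ..
qed

end

theorem theorem2p10:
  fixes scale :: "'k::field_char_0 \<Rightarrow> 'a::ab_group_add \<Rightarrow> 'a" and Basis :: "'a set"
  assumes "finite_dimensional_vector_space scale Basis"
  shows
    "graded_lie_algebra (tuple_scale scale) (compat_component scale)
       (extend_bracket (compat_bracket scale))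
     \<and>
     graded_lie_morphism
       (tuple_scale scale) (compat_component scale) (extend_bracket (compat_bracket scale))
       (cochain_scale scale) (gerst_component scale) (extend_bracket (gerst_bracket scale))
       (extend_map tuple_sum)
     \<and>
     (\<forall>\<mu>1\<in>cochains scale 2. \<forall>\<mu>2\<in>cochains scale 2.
       compatible_associative scale (\<lambda>a b. \<mu>1 [a, b]) (\<lambda>a b. \<mu>2 [a, b]) \<longleftrightarrow>
       maurer_cartan (compat_component scale) (extend_bracket (compat_bracket scale))
         (Poly_Mapping.single 1 (pair_tuple \<mu>1 \<mu>2)))"
proof -
  interpret finite_dimensional_vector_space scale Basis by fact
  have compat: "degreewise_lie_algebra (tuple_scale scale) (compat_component scale) (compat_bracket scale)"
    by (rule compat_degreewise_lie_algebra) (rule infinite_UNIV_char_0)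
  show ?thesis
  proof (intro conjI ballI)
    show "graded_lie_algebra (tuple_scale scale) (compat_component scale)
       (extend_bracket (compat_bracket scale))"
      using compat by (rule degreewise_lie_algebra.graded_lie_algebra)
    show "graded_lie_morphism
       (tuple_scale scale) (compat_component scale) (extend_bracket (compat_bracket scale))
       (cochain_scale scale) (gerst_component scale) (extend_bracket (gerst_bracket scale))
       (extend_map tuple_sum)"
      unfolding eval_tuple_1[symmetric]
    proof (rule graded_lie_morphism_extend_map[OF compat gerst_degreewise_lie_algebra])
      fix m n F G
      show "Vector_Spaces.linear (tuple_scale scale) (cochain_scale scale) (eval_tuple scale 1 n)"
        by (rule eval_tuple_linear)
      assume F: "F \<in> compat_component scale m"
      then show "eval_tuple scale 1 m F \<in> gerst_component scale m"
        by (rule eval_tuple_mem)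
      assume "G \<in> compat_component scale n"
      with F show "eval_tuple scale 1 (m + n) (compat_bracket scale m n F G) =
          gerst_bracket scale m n (eval_tuple scale 1 m F) (eval_tuple scale 1 n G)"
        by (rule eval_tuple_compat_bracket)
    qed
  qed (simp add: compatible_associative_iff_maurer_cartan)
qed

end
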